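(* Let $X$ be a sufficiently large positive real number and define $$\Gamma(X)=\sum_{1\leq n\leq X}\mu^2(n^2+1)\,\mu^2(n^2+2),$$ where $n$ runs over positive integers and $\mu$ is the Möbius function. Then for every $\varepsilon>0$, $$\Gamma(X)=\sigma X+O\!\left(X^{\frac{8}{9}+\varepsilon}\right),$$ where the implied constant depends only on $\varepsilon$, and $$\sigma=\prod_{p>2}\left(1-\frac{\left(\frac{-1}{p}\right)+\left(\frac{-2}{p}\right)+2}{p^2}\right),$$ the product being over odd primes $p$.
   Context: $\mu(n)$ denotes the Möbius function, so $\mu^2(m)=1$ if $m$ is square-free and $0$ otherwise. For an odd prime $p$, $\left(\frac{\cdot}{p}\right)$ denotes the Legendre symbol. *)

theory Defs
  imports "HOL-Analysis.Analysis" "HOL-Number_Theory.Number_Theory"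
    "HOL-Computational_Algebra.Squarefree" "HOL-Library.Landau_Symbols"
begin

definition mu_sq :: "nat \<Rightarrow> real" where
  "mu_sq m = (if squarefree m then 1 else 0)"

definition Gamma_count :: "real \<Rightarrow> real" where
  "Gamma_count X = (\<Sum>n\<in>{n::nat. 1 \<le> n \<and> real n \<le> X}. mu_sq (n^2+1) * mu_sq (n^2+2))"

definition sigma_factor :: "nat \<Rightarrow> real" where
  "sigma_factor p = (if prime p \<and> p > 2 then
     1 - (real_of_int (Legendre (-1) (int p)) + real_of_int (Legendre (-2) (int p)) + 2) / (real p)^2
   else 1)"

definition sigma_const :: real where
  "sigma_const = (\<Prod>p. sigma_factor p)"

end

theory Submission
  imports Defs
begin

text \<open>
  Since \<open>n\<^sup>2 + 1\<close> and \<open>n\<^sup>2 + 2\<close> are coprime, one counts the \<open>n\<close> for which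
  \<open>f(n) = (n\<^sup>2 + 1) (n\<^sup>2 + 2)\<close> is squarefree, expanding the indicator as
  the sum of \<open>\<mu>(d)\<close> over \<open>d\<^sup>2 | f(n)\<close>. If \<open>\<rho>(d)\<close> is the number of roots of \<open>f\<close> modulo \<open>d\<^sup>2\<close>, the
  \<open>d \<le> X\<^bsup>2/3\<^esup>\<close> contribute the main term up to \<open>X\<^bsup>2/3+\<epsilon>\<^esup>\<close>, because \<open>\<rho>(d) \<le> 4\<^bsup>\<omega>(d)\<^esup>\<close> on
  squarefree \<open>d\<close>. For larger \<open>d\<close>, some \<open>e > X\<^bsup>1/3\<^esup>\<close> has \<open>e\<^sup>2 | n\<^sup>2 + c\<close> with
  \<open>c \<in> {1, 2}\<close>. Such \<open>n\<close> with \<open>e \<le> X\<^bsup>7/9\<^esup>\<close> are again counted through \<open>\<rho>\<close>; those with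
  \<open>e > X\<^bsup>7/9\<^esup>\<close> solve one of \<open>O(X\<^bsup>4/9\<^esup>)\<close> Pell-type equations \<open>n\<^sup>2 + c = k e\<^sup>2\<close>, each of which has
  only \<open>O(X\<^bsup>2/9\<^esup>)\<close> admissible solutions because the values of \<open>e\<close> are spaced by at least \<open>X\<^bsup>7/9\<^esup>/2\<close>.
  This even gives the error \<open>X\<^bsup>7/9+\<epsilon>\<^esup>\<close>.
\<close>

subsection \<open>Squarefree divisors\<close>

lemma squarefree_eq_prod_prime_factors:
  fixes d :: nat
  assumes "squarefree d"
  shows "\<Prod>(prime_factors d) = d"
proof -
  have d0: "d \<noteq> 0" using assms by (metis not_squarefree_0)
  have "d = (\<Prod>p\<in>prime_factors d. p ^ multiplicity p d)"
    using d0 by (intro prime_factorization_nat) auto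
  also have "\<dots> = \<Prod>(prime_factors d)"
    using assms d0 squarefree_factorial_semiring'[of d] by (intro prod.cong) auto
  finally show ?thesis by simp
qed

lemma squarefree_prod_primes:
  fixes S :: "nat set"
  assumes "\<And>p. p \<in> S \<Longrightarrow> prime p"
  shows "squarefree (\<Prod>S)"
  by (rule squarefree_prod_coprime) (auto simp: assms primes_coprime squarefree_prime)

lemma prime_factors_prod_primes:
  fixes S :: "nat set"
  assumes "finite S" "\<And>p. p \<in> S \<Longrightarrow> prime p"
  shows "prime_factors (\<Prod>S) = S"
proof -
  have "prime_factors (\<Prod>S) = (\<Union>p\<in>S. prime_factors p)"
    using prime_factors_prod[of S "\<lambda>p. p"] assms(2) by (simp add: assms(1) image_def) (metis not_prime_0)
  also have "\<dots> = S" using assms(2) by (auto simp: prime_factorization_prime)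
  finally show ?thesis .
qed

definition squarefree_over :: "nat set \<Rightarrow> nat set" where
  "squarefree_over T = {d. squarefree d \<and> prime_factors d \<subseteq> T}"

text \<open>A squarefree number is determined by its set of primes, so sums over
  \<open>squarefree_over T\<close> become sums over subsets of \<open>T\<close>, with 1 matching the
  empty set.\<close>

lemma bij_betw_squarefree_over:
  assumes "finite T" "\<And>p. p \<in> T \<Longrightarrow> prime p"
  shows "bij_betw prime_factors (squarefree_over T) (Pow T)"
proof (rule bij_betw_byWitness[where f' = "\<lambda>S. \<Prod>S"])
  show "\<forall>d\<in>squarefree_over T. \<Prod>(prime_factors d) = d"
    by (auto simp: squarefree_over_def squarefree_eq_prod_prime_factors)
  have *: "prime_factors (\<Prod>S) = S" "squarefree (\<Prod>S)" if "S \<subseteq> T" for S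
    using that assms finite_subset[OF that]
    by (auto intro!: prime_factors_prod_primes squarefree_prod_primes)
  show "\<forall>S\<in>Pow T. prime_factors (\<Prod>S) = S" using * by auto
  show "prime_factors ` squarefree_over T \<subseteq> Pow T" by (auto simp: squarefree_over_def)
  show "(\<lambda>S. \<Prod>S) ` Pow T \<subseteq> squarefree_over T"
    using * by (auto simp: squarefree_over_def)
qed

lemma finite_squarefree_over:
  assumes "finite T" "\<And>p. p \<in> T \<Longrightarrow> prime p"
  shows "finite (squarefree_over T)"
  using bij_betw_finite[OF bij_betw_squarefree_over[OF assms]] assms(1) by simp

text \<open>Expanding the product gives one term per subset of \<open>T\<close>. The constant
  \<open>h = -1\<close> later yields the squarefree indicator, and
  \<open>h p = - (rho p / p^2)\<close> the singular series.\<close>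

lemma sum_squarefree_over:
  fixes h :: "nat \<Rightarrow> 'a :: comm_semiring_1"
  assumes "finite T" "\<And>p. p \<in> T \<Longrightarrow> prime p"
  shows "(\<Sum>d\<in>squarefree_over T. \<Prod>p\<in>prime_factors d. h p) = (\<Prod>p\<in>T. h p + 1)"
proof -
  have "(\<Sum>d\<in>squarefree_over T. \<Prod>p\<in>prime_factors d. h p) = (\<Sum>S\<in>Pow T. \<Prod>p\<in>S. h p)"
    by (rule sum.reindex_bij_betw[OF bij_betw_squarefree_over[OF assms]])
  also have "\<dots> = (\<Prod>p\<in>T. h p + 1)" by (simp add: prod_add[OF assms(1)])
  finally show ?thesis .
qed

section \<open>Moebius expansion over square divisors\<close>

definition square_primes :: "nat \<Rightarrow> nat set" where
  "square_primes m = {p. prime p \<and> p\<^sup>2 dvd m}"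

lemma square_primes_subset:
  "m > 0 \<Longrightarrow> square_primes m \<subseteq> prime_factors m"
  by (auto simp: square_primes_def prime_factors_dvd power2_eq_square dest: dvd_mult_left)

lemma finite_square_primes: "m > 0 \<Longrightarrow> finite (square_primes m)"
  using square_primes_subset finite_subset by blast

lemma prime_square_primes: "p \<in> square_primes m \<Longrightarrow> prime p"
  by (simp add: square_primes_def)

text \<open>Squares of distinct primes are coprime, so for squarefree \<open>d\<close> the condition
  \<open>d^2 dvd m\<close> is decided prime by prime.\<close>

lemma squarefree_over_square_primes:
  "squarefree_over (square_primes m) = {d. squarefree d \<and> d\<^sup>2 dvd m}"
proof -
  have "prime_factors d \<subseteq> square_primes m \<longleftrightarrow> d\<^sup>2 dvd m" if d: "squarefree d" for d
  proof
    assume *: "d\<^sup>2 dvd m"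
    show "prime_factors d \<subseteq> square_primes m"
    proof
      fix p assume p: "p \<in> prime_factors d"
      have "p dvd d" using p by (rule in_prime_factors_imp_dvd)
      then have "p\<^sup>2 dvd d\<^sup>2" by (rule dvd_power_same)
      then have "p\<^sup>2 dvd m" using * dvd_trans by blast
      then show "p \<in> square_primes m"
        using p in_prime_factors_imp_prime unfolding square_primes_def by blast
    qed
  next
    assume *: "prime_factors d \<subseteq> square_primes m"
    have "(\<Prod>p\<in>S. p\<^sup>2) dvd m" if "S \<subseteq> prime_factors d" for S
    proof -
      have "finite S" using that finite_subset by blast
      then show ?thesis using that
      proof (induction S)
        case (insert p S)
        have "coprime (p\<^sup>2) (\<Prod>p\<in>S. p\<^sup>2)"
          using insert by (intro prod_coprime_right) (auto intro!: primes_coprime)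
        moreover have "p\<^sup>2 dvd m" using insert * by (auto simp: square_primes_def)
        ultimately show ?case using insert by (auto intro!: divides_mult)
      qed auto
    qed
    then have "(\<Prod>p\<in>prime_factors d. p\<^sup>2) dvd m" by blast
    then show "d\<^sup>2 dvd m"
      using squarefree_eq_prod_prime_factors[OF d] by (simp add: prod_power_distrib[symmetric])
  qed
  then show ?thesis by (auto simp: squarefree_over_def)
qed

text \<open>Only agrees with the Moebius function at squarefree arguments.\<close>
definition mob :: "nat \<Rightarrow> real" where
  "mob d = (-1) ^ card (prime_factors d)"

lemma sum_mob_square_divisors:
  assumes "m > 0"
  shows "(\<Sum>d | squarefree d \<and> d\<^sup>2 dvd m. mob d) = (if squarefree m then 1 else 0)"
proof -
  have "(\<Sum>d | squarefree d \<and> d\<^sup>2 dvd m. mob d) =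
        (\<Sum>d\<in>squarefree_over (square_primes m). \<Prod>p\<in>prime_factors d. - 1)"
    by (simp add: squarefree_over_square_primes mob_def)
  also have "\<dots> = (\<Prod>p\<in>square_primes m. (-1) + 1)"
    using assms by (intro sum_squarefree_over finite_square_primes prime_square_primes)
  \<comment> \<open>The product is \<open>0 ^ card (square_primes m)\<close>, and
    \<open>0 ^ 0 = 1\<close> gives the value 1 on the empty set.\<close>
  also have "\<dots> = (if square_primes m = {} then 1 else 0)"
    using finite_square_primes[OF assms] by (simp add: card_gt_0_iff)
  also have "square_primes m = {} \<longleftrightarrow> squarefree m"
    using assms by (auto simp: squarefree_factorial_semiring square_primes_def)
  finally show ?thesis by simp
qed

lemma finite_square_divisors:
  fixes m :: nat
  assumes "m > 0"
  shows "finite {d. squarefree d \<and> d\<^sup>2 dvd m}"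
  unfolding squarefree_over_square_primes[symmetric]
  by (intro finite_squarefree_over finite_square_primes assms prime_square_primes)

text \<open>Such \<open>d\<close> correspond to subsets of \<open>square_primes m\<close>. This
  later bounds the number of divisor terms attached to a single \<open>n\<close>.\<close>

lemma card_square_divisors_le:
  fixes m :: nat
  assumes "m > 0"
  shows "card {d. squarefree d \<and> d\<^sup>2 dvd m} \<le> 2 ^ card (prime_factors m)"
proof -
  have "card {d. squarefree d \<and> d\<^sup>2 dvd m} = card (Pow (square_primes m))"
    using bij_betw_same_card[OF bij_betw_squarefree_over[OF finite_square_primes[OF assms] prime_square_primes]]
    by (simp add: squarefree_over_square_primes)
  also have "\<dots> = 2 ^ card (square_primes m)" by (simp add: card_Pow finite_square_primes assms)
  also have "\<dots> \<le> 2 ^ card (prime_factors m)"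
    using card_mono[OF _ square_primes_subset[OF assms]] by (intro power_increasing) auto
  finally show ?thesis .
qed

text \<open>A prime \<open>p > N\<close> satisfies \<open>a \<le> p powr \<delta>\<close>, so its
  factor \<open>a\<close> is absorbed into \<open>d powr \<delta>\<close>; the at most
  \<open>N\<close> smaller primes cost at most the constant \<open>a ^ N\<close>.\<close>

lemma power_omega_bound:
  assumes "\<delta> > 0" "a \<ge> 1"
  obtains K :: real where "K \<ge> 1" "\<And>d. d > 0 \<Longrightarrow> a ^ card (prime_factors d) \<le> K * real d powr \<delta>"
proof -
  define N where "N = nat \<lceil>a powr (1 / \<delta>)\<rceil>"
  define K where "K = a ^ N"
  have "a ^ card (prime_factors d) \<le> K * real d powr \<delta>" if "d > 0" for d
  proof -
    let ?L = "{p \<in> prime_factors d. p \<le> N}" and ?H = "{p \<in> prime_factors d. p > N}"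
    have "?L \<subseteq> {1..N}" by (auto dest!: in_prime_factors_imp_prime simp: prime_gt_0_nat Suc_le_eq)
    then have cL: "card ?L \<le> N" using card_mono[of "{1..N}" ?L] by simp
    have ge: "a \<le> real p powr \<delta>" if "p > N" for p
    proof -
      have "a powr (1 / \<delta>) \<le> real p" using that unfolding N_def by linarith
      then have "(a powr (1 / \<delta>)) powr \<delta> \<le> real p powr \<delta>" using assms by (intro powr_mono2) auto
      then show ?thesis using assms by (simp add: powr_powr)
    qed
    have "card (prime_factors d) = card ?L + card ?H"
      by (subst card_Un_disjoint[symmetric]) (auto intro!: arg_cong[where f = card])
    then have "a ^ card (prime_factors d) = a ^ card ?L * a ^ card ?H" by (simp add: power_add)
    also have "\<dots> \<le> K * (\<Prod>p\<in>?H. real p powr \<delta>)"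
    proof (rule mult_mono)
      show "a ^ card ?L \<le> K" unfolding K_def using cL assms by (intro power_increasing) auto
      have "(\<Prod>p\<in>?H. a) \<le> (\<Prod>p\<in>?H. real p powr \<delta>)" using assms ge by (intro prod_mono) auto
      then show "a ^ card ?H \<le> (\<Prod>p\<in>?H. real p powr \<delta>)" by simp
    qed (use assms K_def in auto)
    also have "(\<Prod>p\<in>?H. real p powr \<delta>) = real (\<Prod>?H) powr \<delta>"
      by (simp add: prod_powr_distrib)
    also have "\<dots> \<le> real d powr \<delta>"
    proof -
      have "\<Prod>?H dvd \<Prod>(prime_factors d)" by (rule prod_dvd_prod_subset) auto
      also have "\<dots> dvd (\<Prod>p\<in>prime_factors d. p ^ multiplicity p d)"
        by (rule prod_dvd_prod) (auto intro!: dvd_power simp: prime_factors_multiplicity)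
      also have "\<dots> = d" using prime_factorization_nat[OF that] by simp
      finally have "\<Prod>?H \<le> d" using that by (intro dvd_imp_le) auto
      then show ?thesis using assms by (intro powr_mono2) (auto simp del: of_nat_prod)
    qed
    finally show ?thesis using assms K_def by (simp add: mult_left_mono)
  qed
  moreover have "K \<ge> 1" using assms unfolding K_def by (simp add: one_le_power)
  ultimately show ?thesis using that by blast
qed

subsection \<open>Periodic counting\<close>

text \<open>Injectivity is the uniqueness half of the Chinese remainder theorem; surjectivity
  follows because both sides have \<open>m * k\<close> elements.\<close>

lemma bij_betw_chinese_remainder:
  fixes m k :: nat
  assumes "coprime m k" "m > 0" "k > 0"
  shows "bij_betw (\<lambda>n. (n mod m, n mod k)) {..<m * k} ({..<m} \<times> {..<k})"
proof -
  have inj: "inj_on (\<lambda>n. (n mod m, n mod k)) {..<m * k}"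
  proof (rule inj_onI)
    fix x y assume *: "x \<in> {..<m * k}" "y \<in> {..<m * k}" "(x mod m, x mod k) = (y mod m, y mod k)"
    then have "[x = y] (mod m * k)"
      using assms(1) by (intro coprime_cong_mult_nat) (auto simp: cong_def)
    then show "x = y" using * by (simp add: cong_def)
  qed
  moreover have "(\<lambda>n. (n mod m, n mod k)) ` {..<m * k} \<subseteq> {..<m} \<times> {..<k}" using assms by auto
  moreover have "card ((\<lambda>n. (n mod m, n mod k)) ` {..<m * k}) = card ({..<m} \<times> {..<k})"
    using card_image[OF inj] by (simp add: card_cartesian_product)
  ultimately show ?thesis
    unfolding bij_betw_def by (metis card_subset_eq finite_cartesian_product finite_lessThan)
qed

lemma card_chinese_remainder:
  fixes m k :: nat
  assumes "coprime m k" "m > 0" "k > 0"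
  shows "card {n. n < m * k \<and> P (n mod m) \<and> Q (n mod k)} = card {n. n < m \<and> P n} * card {n. n < k \<and> Q n}"
proof -
  let ?g = "\<lambda>n. (n mod m, n mod k)"
  have bij: "bij_betw ?g {..<m * k} ({..<m} \<times> {..<k})" by (rule bij_betw_chinese_remainder[OF assms])
  have "bij_betw ?g {n. n < m * k \<and> P (n mod m) \<and> Q (n mod k)} ({n. n < m \<and> P n} \<times> {n. n < k \<and> Q n})"
  proof (rule bij_betw_subset[OF bij])
    show "?g ` {n. n < m * k \<and> P (n mod m) \<and> Q (n mod k)} = {n. n < m \<and> P n} \<times> {n. n < k \<and> Q n}"
    proof (intro equalityI subsetI)
      fix x assume x: "x \<in> {n. n < m \<and> P n} \<times> {n. n < k \<and> Q n}"
      then have "x \<in> ?g ` {..<m * k}" using bij by (auto simp: bij_betw_def)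
      then show "x \<in> ?g ` {n. n < m * k \<and> P (n mod m) \<and> Q (n mod k)}" using x by auto
    qed (use assms in auto)
  qed auto
  then show ?thesis by (simp add: bij_betw_same_card card_cartesian_product)
qed

lemma card_periodic_multiple:
  fixes m q :: nat
  assumes "m > 0"
  shows "card {n. n < m * q \<and> P (n mod m)} = q * card {n. n < m \<and> P n}"
proof -
  have "bij_betw (\<lambda>n. (n div m, n mod m)) {n. n < m * q \<and> P (n mod m)} ({..<q} \<times> {n. n < m \<and> P n})"
  proof (rule bij_betw_byWitness[where f' = "\<lambda>(a, b). a * m + b"])
    show "(\<lambda>(a, b). a * m + b) ` ({..<q} \<times> {n. n < m \<and> P n}) \<subseteq> {n. n < m * q \<and> P (n mod m)}"
    proof clarsimp
      fix a b assume "a < q" "b < m"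
      then have "a * m + b < (a + 1) * m" by simp
      also have "\<dots> \<le> q * m" using \<open>a < q\<close> by (intro mult_right_mono) auto
      finally show "a * m + b < m * q" by (simp add: mult.commute)
    qed
  qed (use assms in \<open>auto simp: less_mult_imp_div_less mult.commute\<close>)
  then show ?thesis by (simp add: bij_betw_same_card card_cartesian_product)
qed

text \<open>With \<open>q = M div m\<close>, both the count and \<open>M * r / m\<close> lie between
  \<open>q * r\<close> and \<open>(q + 1) * r\<close>, so they differ by at most the count
  \<open>r\<close> of one period.\<close>

lemma card_periodic_bounds:
  fixes m M :: nat and P :: "nat \<Rightarrow> bool"
  assumes "m > 0"
  defines "r \<equiv> real (card {n. n < m \<and> P n})"
  shows "\<bar>real (card {n. n < M \<and> P (n mod m)}) - real M * r / real m\<bar> \<le> r"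
proof -
  let ?A = "\<lambda>M. {n. n < M \<and> P (n mod m)}"
  define q where "q = M div m"
  have M: "m * q \<le> M" "M \<le> m * (q + 1)"
    unfolding q_def using assms(1) by (auto simp: less_imp_le dividend_less_times_div)
  have "card (?A (m * q)) \<le> card (?A M)" "card (?A M) \<le> card (?A (m * (q + 1)))"
    using M by (auto intro!: card_mono)
  then have A: "real q * r \<le> real (card (?A M))" "real (card (?A M)) \<le> (real q + 1) * r"
    unfolding card_periodic_multiple[OF assms(1)] r_def
    by (metis of_nat_le_iff of_nat_mult, metis of_nat_le_iff of_nat_mult of_nat_add of_nat_1)
  have "real q \<le> real M / real m" "real M / real m \<le> real q + 1"
    using M assms(1) by (simp_all add: field_simps) (metis of_nat_le_iff of_nat_mult, metis of_nat_le_iff of_nat_mult of_nat_add distrib_left mult.right_neutral)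
  then have "real q * r \<le> real M / real m * r" "real M / real m * r \<le> (real q + 1) * r"
    by (intro mult_right_mono; simp add: r_def)+
  then show ?thesis using A by (auto simp: abs_le_iff algebra_simps)
qed

section \<open>The quartic and its roots modulo squares\<close>

definition quart :: "nat \<Rightarrow> nat" where
  "quart n = (n\<^sup>2 + 1) * (n\<^sup>2 + 2)"

definition rho :: "nat \<Rightarrow> nat" where
  "rho d = card {n. n < d\<^sup>2 \<and> d\<^sup>2 dvd quart n}"

lemma coprime_quart_factors: "coprime (n\<^sup>2 + 1) (n\<^sup>2 + 2 :: nat)"
  using coprime_Suc_right_nat[of "n\<^sup>2 + 1"] by simp

lemma quart_pos: "quart n > 0"
  by (simp add: quart_def)

lemma quart_mod_dvd_iff: "k dvd quart (n mod k) \<longleftrightarrow> k dvd quart n"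
proof -
  have "[quart (n mod k) = quart n] (mod k)"
    unfolding quart_def by (intro cong_mult cong_add cong_pow) (auto simp: cong_def)
  then show ?thesis by (rule cong_dvd_iff)
qed

text \<open>Coprimality of the two factors lets the product of two squarefree indicators be handled
  as one.\<close>

lemma squarefree_quart_iff: "squarefree (quart n) \<longleftrightarrow> squarefree (n\<^sup>2 + 1) \<and> squarefree (n\<^sup>2 + 2)"
  unfolding quart_def using coprime_quart_factors squarefree_multD squarefree_mult_coprime by metis

text \<open>The Chinese remainder theorem for the coprime moduli \<open>a^2\<close> and
  \<open>b^2\<close>.\<close>

lemma rho_mult:
  assumes "coprime a b" "a > 0" "b > 0"
  shows "rho (a * b) = rho a * rho b"
proof -
  have cop: "coprime (a\<^sup>2) (b\<^sup>2)" using assms by simp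
  have dvd: "(a * b)\<^sup>2 dvd quart n \<longleftrightarrow> a\<^sup>2 dvd quart (n mod a\<^sup>2) \<and> b\<^sup>2 dvd quart (n mod b\<^sup>2)" for n
    using cop by (auto simp: quart_mod_dvd_iff power_mult_distrib intro: divides_mult dvd_mult_left dvd_mult_right)
  show ?thesis
    unfolding rho_def dvd unfolding power_mult_distrib
    using card_chinese_remainder[OF cop, of "\<lambda>n. a\<^sup>2 dvd quart n" "\<lambda>n. b\<^sup>2 dvd quart n"] assms by simp
qed

lemma rho_1 [simp]: "rho (Suc 0) = 1"
proof -
  have "{n. n < 1 \<and> 1 dvd quart n} = {0}" by auto
  then show ?thesis by (simp add: rho_def)
qed

lemma rho_squarefree:
  assumes "squarefree d"
  shows "rho d = (\<Prod>p\<in>prime_factors d. rho p)"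
proof -
  have "rho (\<Prod>S) = (\<Prod>p\<in>S. rho p)" if "finite S" "\<And>p. p \<in> S \<Longrightarrow> prime p" for S
    using that
  proof (induction S)
    case (insert p S)
    have "coprime p (\<Prod>S)" using insert by (intro prod_coprime_right) (auto intro!: primes_coprime)
    moreover have "\<Prod>S > 0" using insert by (intro prod_pos) (auto simp: prime_gt_0_nat)
    ultimately show ?case using insert by (simp add: rho_mult prime_gt_0_nat)
  qed auto
  from this[of "prime_factors d"] show ?thesis
    using squarefree_eq_prod_prime_factors[OF assms] by auto
qed

lemma card_square_dvd_quart_bounds:
  assumes "d > 0"
  shows "\<bar>real (card {n. n < M \<and> d\<^sup>2 dvd quart n}) - real M * (real (rho d) / real d ^ 2)\<bar> \<le> real (rho d)"
  using card_periodic_bounds[of "d\<^sup>2" M "\<lambda>n. d\<^sup>2 dvd quart n"] assms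
  by (simp add: rho_def quart_mod_dvd_iff)

subsection \<open>Roots modulo squares of primes\<close>

text \<open>The derivative \<open>2 * x\<close> of \<open>x^2 - a\<close> at a root is invertible
  modulo \<open>p\<close>. This drives both the lifting of a root and the separation of
  \<open>y\<close> from \<open>-y\<close>.\<close>

lemma prime_not_dvd_double_root:
  fixes p a x :: int
  assumes "prime p" "odd p" "\<not> p dvd a" "p dvd x\<^sup>2 - a"
  shows "\<not> p dvd 2 * x"
proof
  assume "p dvd 2 * x"
  moreover have "\<not> p dvd 2"
    using assms(1,2) primes_dvd_imp_eq[of p 2] by auto
  ultimately have "p dvd x" using assms(1) prime_dvd_multD by blast
  then have "p dvd x\<^sup>2" by (simp add: power2_eq_square)
  then have "p dvd x\<^sup>2 - (x\<^sup>2 - a)" using assms(4) by (rule dvd_diff)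
  then show False using assms(3) by simp
qed

lemma hensel_square_root:
  fixes p a x :: int
  assumes "prime p" "odd p" "\<not> p dvd a" "[x\<^sup>2 = a] (mod p)"
  obtains y where "[y\<^sup>2 = a] (mod p\<^sup>2)"
proof -
  obtain k where k: "x\<^sup>2 - a = p * k" using assms(4) by (auto simp: cong_iff_dvd_diff)
  have "\<not> p dvd 2 * x" using prime_not_dvd_double_root[OF assms(1-3), of x] k by simp
  then have "coprime (2 * x) p" using assms(1) prime_imp_coprime coprime_commute by blast
  then obtain u where u: "[2 * x * u = 1] (mod p)" using cong_solve_coprime_int by blast
  then obtain v where v: "2 * x * u = 1 + p * v" using cong_sym cong_iff_lin by blast
  define t where "t = - k * u"
  have "(x + t * p)\<^sup>2 - a = p * (k + 2 * x * t) + p\<^sup>2 * t\<^sup>2"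
    using k by (simp add: power2_eq_square algebra_simps)
  also have "k + 2 * x * t = p * (- k * v)"
  proof -
    have "k + 2 * x * t = k - k * (2 * x * u)" by (simp add: t_def algebra_simps)
    then show ?thesis using v by (simp add: algebra_simps)
  qed
  also have "p * (p * (- k * v)) + p\<^sup>2 * t\<^sup>2 = p\<^sup>2 * (t\<^sup>2 - k * v)"
    by (simp add: power2_eq_square algebra_simps)
  finally have "[(x + t * p)\<^sup>2 = a] (mod p\<^sup>2)" by (simp add: cong_iff_dvd_diff)
  then show ?thesis by (rule that)
qed

text \<open>As \<open>p\<close> does not divide \<open>c\<close>, the Legendre symbol is -1 or 1. In
  the first case there is no root even modulo \<open>p\<close>; in the second a root lifts to some
  \<open>y\<close> modulo \<open>p^2\<close>, and \<open>y\<close> and \<open>-y\<close> give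
  exactly two residues.\<close>

lemma card_square_roots_mod_prime_square:
  fixes p :: nat and c :: nat
  assumes "prime p" "odd p" "\<not> p dvd c"
  shows "int (card {n. n < p\<^sup>2 \<and> p\<^sup>2 dvd n\<^sup>2 + c}) = 1 + Legendre (- int c) (int p)"
proof -
  let ?p = "int p"
  define S where "S = {n. n < p\<^sup>2 \<and> p\<^sup>2 dvd n\<^sup>2 + c}"
  have pr: "prime ?p" "odd ?p" "?p > 0" using assms by (auto simp: prime_gt_0_nat)
  have pc: "\<not> ?p dvd - int c" using assms by (simp add: int_dvd_int_iff)
  then have n0: "\<not> [- int c = 0] (mod ?p)" by (simp add: cong_0_iff)
  have S_iff: "n \<in> S \<longleftrightarrow> n < p\<^sup>2 \<and> ?p\<^sup>2 dvd (int n)\<^sup>2 + int c" for n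
  proof -
    have "?p\<^sup>2 dvd (int n)\<^sup>2 + int c \<longleftrightarrow> int (p\<^sup>2) dvd int (n\<^sup>2 + c)" by simp
    also have "\<dots> \<longleftrightarrow> p\<^sup>2 dvd n\<^sup>2 + c" by (rule int_dvd_int_iff)
    finally show ?thesis by (simp add: S_def)
  qed
  show ?thesis
  proof (cases "QuadRes ?p (- int c)")
    case False
    have "S = {}"
    proof (rule ccontr)
      assume "S \<noteq> {}"
      then obtain n where "?p\<^sup>2 dvd (int n)\<^sup>2 + int c" using S_iff by auto
      then have "?p dvd (int n)\<^sup>2 - (- int c)" using dvd_trans[of ?p "?p\<^sup>2"] by simp
      then have "[(int n)\<^sup>2 = - int c] (mod ?p)" by (simp only: cong_iff_dvd_diff)
      then show False using False by (auto simp: QuadRes_def)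
    qed
    then show ?thesis using False n0 by (simp add: Legendre_def S_def)
  next
    case True
    then obtain x where "[x\<^sup>2 = - int c] (mod ?p)" by (auto simp: QuadRes_def)
    then obtain y where y: "[y\<^sup>2 = - int c] (mod ?p\<^sup>2)" using hensel_square_root pr pc by blast
    then have y': "?p\<^sup>2 dvd y\<^sup>2 + int c" by (simp add: cong_iff_dvd_diff)
    then have "?p dvd y\<^sup>2 - (- int c)" using dvd_trans[of ?p "?p\<^sup>2"] by simp
    then have p2y: "\<not> ?p dvd 2 * y" using prime_not_dvd_double_root[OF pr(1,2) pc] by blast
    \<comment> \<open>\<open>r z\<close> is the natural number below \<open>p^2\<close> representing
      the integer \<open>z\<close>; it carries integer roots into the set \<open>S\<close>.\<close>
    define r where "r z = nat (z mod ?p\<^sup>2)" for z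
    have pos: "?p\<^sup>2 > 0" using pr by simp
    have r_int: "int (r z) = z mod ?p\<^sup>2" for z using pos by (simp add: r_def)
    have r_less: "r z < p\<^sup>2" for z
    proof -
      have "int (r z) < int (p\<^sup>2)" using pos_mod_bound[OF pos, of z] r_int[of z] by simp
      then show ?thesis by linarith
    qed
    have r_eq: "r z = n \<longleftrightarrow> ?p\<^sup>2 dvd int n - z" if "n < p\<^sup>2" for z n
    proof -
      have "r z = n \<longleftrightarrow> z mod ?p\<^sup>2 = int n" using r_int[of z] by auto
      also have "\<dots> \<longleftrightarrow> z mod ?p\<^sup>2 = int n mod ?p\<^sup>2" using that by (simp flip: of_nat_power)
      finally show ?thesis by (simp add: mod_eq_dvd_iff dvd_diff_commute)
    qed
    have "S = {r y, r (- y)}"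
    proof (intro equalityI subsetI)
      fix n assume n: "n \<in> S"
      have "?p\<^sup>2 dvd ((int n)\<^sup>2 + int c) - (y\<^sup>2 + int c)" using n y' S_iff by (intro dvd_diff) auto
      then have d: "?p\<^sup>2 dvd (int n - y) * (int n + y)" by (simp add: power2_eq_square algebra_simps)
      \<comment> \<open>The two factors differ by \<open>2 * y\<close>, which \<open>p\<close> does
        not divide. Hence all of \<open>p^2\<close> must go into a single factor.\<close>
      have "\<not> (?p dvd int n - y \<and> ?p dvd int n + y)"
      proof
        assume "?p dvd int n - y \<and> ?p dvd int n + y"
        then have "?p dvd (int n + y) - (int n - y)" by (blast intro: dvd_diff)
        moreover have "(int n + y) - (int n - y) = 2 * y" by simp
        ultimately show False using p2y by metis
      qed
      then have "coprime (?p\<^sup>2) (int n - y) \<or> coprime (?p\<^sup>2) (int n + y)"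
        using pr prime_imp_coprime[of ?p "int n - y"] prime_imp_coprime[of ?p "int n + y"] by auto
      then have "?p\<^sup>2 dvd int n - y \<or> ?p\<^sup>2 dvd int n + y"
        using d coprime_dvd_mult_right_iff coprime_dvd_mult_left_iff by blast
      then show "n \<in> {r y, r (- y)}" using n r_eq[of n y] r_eq[of n "- y"] S_iff by auto
    next
      have "r z \<in> S" if "z\<^sup>2 = y\<^sup>2" for z
      proof -
        have "[(int (r z))\<^sup>2 + int c = z\<^sup>2 + int c] (mod ?p\<^sup>2)"
          by (intro cong_add cong_pow) (auto simp: r_int cong_def)
        then show ?thesis using that y' S_iff r_less by (simp add: cong_dvd_iff)
      qed
      then show "n \<in> S" if "n \<in> {r y, r (- y)}" for n using that by auto
    qed
    moreover have "r y \<noteq> r (- y)"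
    proof
      assume "r y = r (- y)"
      then have "y mod ?p\<^sup>2 = (- y) mod ?p\<^sup>2" using r_int by metis
      then have "?p\<^sup>2 dvd 2 * y" by (simp add: mod_eq_dvd_iff)
      then show False using p2y dvd_trans[of ?p "?p\<^sup>2"] by simp
    qed
    ultimately have "card S = 2" by simp
    then show ?thesis using True n0 by (simp add: Legendre_def S_def)
  qed
qed

text \<open>The two factors of \<open>quart n\<close> are coprime, so \<open>p\<close> divides at
  most one of them, and that one must take the whole square.\<close>

lemma prime_square_dvd_quart_iff:
  assumes "prime p"
  shows "p\<^sup>2 dvd quart n \<longleftrightarrow> p\<^sup>2 dvd n\<^sup>2 + 1 \<or> p\<^sup>2 dvd n\<^sup>2 + 2"
proof
  assume *: "p\<^sup>2 dvd quart n"
  have "\<not> (p dvd n\<^sup>2 + 1 \<and> p dvd n\<^sup>2 + 2)"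
    using assms coprime_quart_factors[of n] not_coprimeI[of p] not_prime_unit by blast
  then have "coprime (p\<^sup>2) (n\<^sup>2 + 1) \<or> coprime (p\<^sup>2) (n\<^sup>2 + 2)"
    using assms prime_imp_coprime by auto
  then show "p\<^sup>2 dvd n\<^sup>2 + 1 \<or> p\<^sup>2 dvd n\<^sup>2 + 2"
    using * coprime_dvd_mult_right_iff coprime_dvd_mult_left_iff unfolding quart_def by blast
next
  assume "p\<^sup>2 dvd n\<^sup>2 + 1 \<or> p\<^sup>2 dvd n\<^sup>2 + 2"
  then show "p\<^sup>2 dvd quart n" unfolding quart_def using dvd_mult dvd_mult2 by blast
qed

text \<open>The roots belonging to \<open>n^2 + 1\<close> and to \<open>n^2 + 2\<close> form
  disjoint sets, each of size one plus a Legendre symbol. This identifies the numerator in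
  \<open>sigma_factor\<close> as a root count.\<close>

lemma rho_odd_prime:
  assumes "prime p" "p > 2"
  shows "int (rho p) = Legendre (-1) (int p) + Legendre (-2) (int p) + 2"
proof -
  have odd: "odd p" using assms prime_odd_nat by auto
  have nd: "\<not> p dvd 1" "\<not> p dvd 2" using assms by (auto dest: dvd_imp_le)
  let ?A = "\<lambda>c. {n. n < p\<^sup>2 \<and> p\<^sup>2 dvd n\<^sup>2 + c}"
  have "rho p = card (?A 1 \<union> ?A 2)"
    unfolding rho_def by (rule arg_cong[where f = card]) (auto simp: prime_square_dvd_quart_iff assms)
  also have "\<dots> = card (?A 1) + card (?A 2)"
  proof (rule card_Un_disjoint)
    have False if "p\<^sup>2 dvd n\<^sup>2 + 1" "p\<^sup>2 dvd n\<^sup>2 + 2" for n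
    proof -
      have "is_unit (p\<^sup>2)" using coprime_common_divisor[OF coprime_quart_factors that] .
      then show False using assms by (simp add: power2_eq_square)
    qed
    then show "?A 1 \<inter> ?A 2 = {}" by blast
  qed auto
  finally show ?thesis
    using card_square_roots_mod_prime_square[OF assms(1) odd nd(1)]
      card_square_roots_mod_prime_square[OF assms(1) odd nd(2)] by simp
qed

text \<open>Residues modulo 4 are checked one by one. This is why the Euler product may start at the
  odd primes.\<close>

lemma rho_2: "rho 2 = 0"
proof -
  have "\<not> 4 dvd quart n" for n
  proof -
    have "n mod 4 = 0 \<or> n mod 4 = 1 \<or> n mod 4 = 2 \<or> n mod 4 = 3" by linarith
    then have "\<not> 4 dvd quart (n mod 4)" by (auto simp: quart_def dvd_eq_mod_eq_0)
    then show ?thesis by (simp add: quart_mod_dvd_iff)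
  qed
  then show ?thesis by (simp add: rho_def)
qed

lemma rho_prime_le: "prime p \<Longrightarrow> rho p \<le> 4"
proof (cases "p > 2")
  case True
  assume "prime p"
  have "Legendre a b \<le> 1" for a b by (simp add: Legendre_def)
  from this[of "-1" "int p"] this[of "-2" "int p"] show ?thesis
    using rho_odd_prime[OF \<open>prime p\<close> True] by linarith
next
  case False
  assume "prime p"
  then show ?thesis using False prime_ge_2_nat[of p] rho_2 by (simp add: not_less)
qed

lemma rho_squarefree_le:
  assumes "squarefree d"
  shows "rho d \<le> 4 ^ card (prime_factors d)"
proof -
  have "(\<Prod>p\<in>prime_factors d. rho p) \<le> (\<Prod>p\<in>prime_factors d. 4)"
    by (intro prod_mono) (auto intro: rho_prime_le)
  then show ?thesis using rho_squarefree[OF assms] by simp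
qed

lemma sigma_factor_eq:
  "sigma_factor p = (if prime p then 1 - real (rho p) / real p ^ 2 else 1)"
proof (cases "prime p \<and> p > 2")
  case True
  then have "real (rho p) = real_of_int (Legendre (-1) (int p) + Legendre (-2) (int p) + 2)"
    using rho_odd_prime[of p] by (metis of_int_of_nat_eq)
  then show ?thesis using True by (simp add: sigma_factor_def)
next
  case False
  then show ?thesis using prime_ge_2_nat[of p] rho_2 by (auto simp: sigma_factor_def not_less)
qed

subsection \<open>The singular series\<close>

lemma rho_powr_bound:
  assumes "\<delta> > 0"
  obtains K :: real where "K \<ge> 1" "\<And>d. d > 0 \<Longrightarrow> 4 ^ card (prime_factors d) \<le> K * real d powr \<delta>"
    "\<And>d. squarefree d \<Longrightarrow> real (rho d) \<le> K * real d powr \<delta>"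
proof -
  obtain K :: real where K: "K \<ge> 1" "\<And>d. d > 0 \<Longrightarrow> 4 ^ card (prime_factors d) \<le> K * real d powr \<delta>"
    using power_omega_bound[OF assms, of 4] by auto
  have "real (rho d) \<le> K * real d powr \<delta>" if "squarefree d" for d
  proof -
    have "d > 0" using that by (metis not_squarefree_0 gr0I)
    have "real (rho d) \<le> real (4 ^ card (prime_factors d))"
      using rho_squarefree_le[OF that] of_nat_le_iff by blast
    also have "\<dots> \<le> K * real d powr \<delta>" using K(2)[OF \<open>d > 0\<close>] by simp
    finally show ?thesis .
  qed
  with K that show ?thesis by blast
qed

text \<open>Each term is at most \<open>K * d powr (\<delta> - 2)\<close>, split as
  \<open>d powr (2 * \<delta> - 1)\<close> times \<open>d powr (- 1 - \<delta>)\<close>. As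
  \<open>\<delta> \<le> 1/2\<close>, the first factor is at most its value at \<open>z\<close>; the
  second is summable.\<close>

lemma rho_tail_bound:
  assumes "0 < \<delta>" "\<delta> \<le> 1/2" "K \<ge> 0" "\<And>d. squarefree d \<Longrightarrow> real (rho d) \<le> K * real d powr \<delta>"
  obtains C :: real where "C \<ge> 0"
    "\<And>z F. z > 0 \<Longrightarrow> finite F \<Longrightarrow> (\<And>d. d \<in> F \<Longrightarrow> squarefree d \<and> z < real d) \<Longrightarrow>
       (\<Sum>d\<in>F. real (rho d) / real d ^ 2) \<le> C * z powr (2 * \<delta> - 1)"
proof -
  have sm: "summable (\<lambda>n. real n powr (- 1 - \<delta>))" using assms by (simp add: summable_real_powr_iff)
  define L where "L = (\<Sum>n. real n powr (- 1 - \<delta>))"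
  have L0: "L \<ge> 0" unfolding L_def by (intro suminf_nonneg sm) auto
  have "(\<Sum>d\<in>F. real (rho d) / real d ^ 2) \<le> (K * L) * z powr (2 * \<delta> - 1)"
    if "z > 0" "finite F" and F: "\<And>d. d \<in> F \<Longrightarrow> squarefree d \<and> z < real d" for z F
  proof -
    have "(\<Sum>d\<in>F. real (rho d) / real d ^ 2) \<le>
          (\<Sum>d\<in>F. K * z powr (2 * \<delta> - 1) * real d powr (- 1 - \<delta>))"
    proof (rule sum_mono)
      fix d assume d: "d \<in> F"
      have d0: "real d > 0" using F[OF d] \<open>z > 0\<close> by linarith
      have "real (rho d) / real d ^ 2 \<le> K * real d powr \<delta> / real d ^ 2"
        using assms(4) F[OF d] by (intro divide_right_mono) auto
      also have "\<dots> = K * (real d powr (2 * \<delta> - 1) * real d powr (- 1 - \<delta>))"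
      proof -
        have "real d powr (2 * \<delta> - 1) * real d powr (- 1 - \<delta>) = real d powr (\<delta> - 2)"
          by (simp add: powr_add[symmetric] algebra_simps)
        also have "\<dots> = real d powr \<delta> / real d ^ 2" using d0 by (simp add: powr_diff powr_numeral)
        finally show ?thesis by simp
      qed
      also have "\<dots> \<le> K * (z powr (2 * \<delta> - 1) * real d powr (- 1 - \<delta>))"
        using assms F[OF d] \<open>z > 0\<close> by (intro mult_left_mono mult_right_mono powr_mono2') auto
      finally show "real (rho d) / real d ^ 2 \<le> K * z powr (2 * \<delta> - 1) * real d powr (- 1 - \<delta>)"
        by (simp add: mult.assoc)
    qed
    also have "\<dots> = K * z powr (2 * \<delta> - 1) * (\<Sum>d\<in>F. real d powr (- 1 - \<delta>))"
      by (simp add: sum_distrib_left)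
    also have "\<dots> \<le> K * z powr (2 * \<delta> - 1) * L"
      unfolding L_def using assms(3) by (intro mult_left_mono sum_le_suminf sm that) auto
    finally show ?thesis by (simp add: mult_ac)
  qed
  moreover have "K * L \<ge> 0" using L0 assms(3) by simp
  ultimately show ?thesis using that by blast
qed

text \<open>Convergence has to be proved before the infinite product in \<open>sigma_const\<close>
  has a meaning; it follows from \<open>rho p \<le> 4\<close> by comparison with the sum of
  \<open>4 / p^2\<close>.\<close>

lemma sigma_LIMSEQ: "(\<lambda>n. \<Prod>p\<le>n. sigma_factor p) \<longlonglongrightarrow> sigma_const"
proof -
  have "summable (\<lambda>p. norm (sigma_factor p - 1))"
  proof (rule summable_comparison_test)
    show "summable (\<lambda>p. 4 * (1 / real p ^ 2))"
      by (intro summable_mult) (use inverse_power_summable[of 2, where 'a = real] in \<open>simp add: divide_inverse\<close>)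
    have "norm (norm (sigma_factor p - 1)) \<le> 4 * (1 / real p ^ 2)" for p
      using rho_prime_le[of p] by (auto simp: sigma_factor_eq intro!: divide_right_mono)
    then show "\<exists>N. \<forall>n\<ge>N. norm (norm (sigma_factor n - 1)) \<le> 4 * (1 / real n ^ 2)" by blast
  qed
  then have "convergent_prod sigma_factor"
    by (intro abs_convergent_prod_imp_convergent_prod summable_imp_abs_convergent_prod)
  then show ?thesis unfolding sigma_const_def by (rule convergent_prod_LIMSEQ)
qed

lemma finite_squarefree_le: "finite {d::nat. squarefree d \<and> real d \<le> z}"
  by (rule finite_subset[of _ "{..nat \<lfloor>z\<rfloor>}"]) (auto simp: le_nat_floor)

text \<open>The finite Euler product is expanded by \<open>sum_squarefree_over\<close>;
  \<open>rho d\<close> and \<open>d^2\<close> factor over the primes of a squarefree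
  \<open>d\<close>.\<close>

lemma sigma_prod_eq_sum:
  "(\<Prod>p\<le>y. sigma_factor p) =
   (\<Sum>d\<in>squarefree_over {p. prime p \<and> p \<le> y}. mob d * (real (rho d) / real d ^ 2))"
proof -
  define T where "T = {p. prime p \<and> p \<le> y}"
  have T: "finite T" "\<And>p. p \<in> T \<Longrightarrow> prime p" by (auto simp: T_def)
  have "(\<Prod>p\<le>y. sigma_factor p) = (\<Prod>p\<in>T. sigma_factor p)"
    by (rule prod.mono_neutral_right) (auto simp: T_def sigma_factor_eq)
  also have "\<dots> = (\<Prod>p\<in>T. - (real (rho p) / real p ^ 2) + 1)"
    by (rule prod.cong) (auto simp: sigma_factor_eq T_def)
  also have "\<dots> = (\<Sum>d\<in>squarefree_over T. \<Prod>p\<in>prime_factors d. - (real (rho p) / real p ^ 2))"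
    using sum_squarefree_over[OF T, of "\<lambda>p. - (real (rho p) / real p ^ 2)"] by simp
  also have "\<dots> = (\<Sum>d\<in>squarefree_over T. mob d * (real (rho d) / real d ^ 2))"
  proof (rule sum.cong)
    fix d assume "d \<in> squarefree_over T"
    then have d: "squarefree d" by (simp add: squarefree_over_def)
    have "real d ^ 2 = (\<Prod>p\<in>prime_factors d. real p ^ 2)"
      by (subst squarefree_eq_prod_prime_factors[OF d, symmetric]) (simp add: prod_power_distrib)
    moreover have "real (rho d) = (\<Prod>p\<in>prime_factors d. real (rho p))"
      using rho_squarefree[OF d] by simp
    ultimately show "(\<Prod>p\<in>prime_factors d. - (real (rho p) / real p ^ 2)) = mob d * (real (rho d) / real d ^ 2)"
      by (simp add: mob_def prod_uminus prod_dividef)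
  qed simp
  finally show ?thesis by (simp add: T_def)
qed

text \<open>Once \<open>y\<close> is at least \<open>z\<close>, the partial product up to
  \<open>y\<close> expands into every squarefree \<open>d \<le> z\<close> plus finitely many
  \<open>d > z\<close>, so it misses the truncated sum by at most \<open>B\<close>; then
  \<open>y\<close> tends to infinity. Stating \<open>tail\<close> for finite sets avoids infinite
  sums.\<close>

lemma sigma_truncation_bound:
  assumes tail: "\<And>F. finite F \<Longrightarrow> (\<And>d. d \<in> F \<Longrightarrow> squarefree d \<and> z < real d) \<Longrightarrow>
       (\<Sum>d\<in>F. real (rho d) / real d ^ 2) \<le> B"
  shows "\<bar>(\<Sum>d | squarefree d \<and> real d \<le> z. mob d * (real (rho d) / real d ^ 2)) - sigma_const\<bar> \<le> B"
proof -
  define G where "G = {d::nat. squarefree d \<and> real d \<le> z}"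
  let ?g = "\<lambda>d. mob d * (real (rho d) / real d ^ 2)"
  have "(\<lambda>y. \<bar>sum ?g G - (\<Prod>p\<le>y. sigma_factor p)\<bar>) \<longlonglongrightarrow> \<bar>sum ?g G - sigma_const\<bar>"
    by (intro tendsto_intros sigma_LIMSEQ)
  moreover have "\<bar>sum ?g G - (\<Prod>p\<le>y. sigma_factor p)\<bar> \<le> B" if y: "y \<ge> nat \<lceil>z\<rceil>" for y
  proof -
    define Q where "Q = squarefree_over {p. prime p \<and> p \<le> y}"
    have fin: "finite Q" unfolding Q_def by (rule finite_squarefree_over) auto
    have "G \<subseteq> Q"
    proof
      fix d assume d: "d \<in> G"
      then have "real d \<le> real y" using y unfolding G_def by (simp add: nat_ceiling_le_eq)
      moreover have "d > 0" using d unfolding G_def by (auto intro: gr0I)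
      ultimately have "p \<le> y" if "p \<in> prime_factors d" for p
        using dvd_imp_le[OF in_prime_factors_imp_dvd[OF that]] by simp
      then show "d \<in> Q" using d by (auto simp: Q_def G_def squarefree_over_def)
    qed
    then have "sum ?g (Q - G) = sum ?g Q - sum ?g G" using fin by (intro sum_diff)
    then have "(\<Prod>p\<le>y. sigma_factor p) - sum ?g G = sum ?g (Q - G)"
      by (simp add: sigma_prod_eq_sum Q_def)
    also have "\<bar>\<dots>\<bar> \<le> (\<Sum>d\<in>Q - G. \<bar>?g d\<bar>)" by (rule sum_abs)
    also have "\<dots> = (\<Sum>d\<in>Q - G. real (rho d) / real d ^ 2)" by (simp add: mob_def abs_mult power_abs)
    also have "\<dots> \<le> B" using fin by (intro tail) (auto simp: Q_def G_def squarefree_over_def)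
    finally show ?thesis by (simp add: abs_minus_commute)
  qed
  ultimately have "\<bar>sum ?g G - sigma_const\<bar> \<le> B"
    by (blast intro: LIMSEQ_le_const2)
  then show ?thesis by (simp add: G_def)
qed

subsection \<open>Large square divisors\<close>

text \<open>Two solutions \<open>(n, e)\<close> of \<open>n\<^sup>2 + c = k e\<^sup>2\<close> satisfy
  \<open>(n\<^sub>2 e\<^sub>1 - n\<^sub>1 e\<^sub>2) (n\<^sub>2 e\<^sub>1 + n\<^sub>1 e\<^sub>2) = c (e\<^sub>2\<^sup>2 - e\<^sub>1\<^sup>2)\<close>, so their values of \<open>e\<close> are well spaced.\<close>
lemma pell_gap:
  fixes n1 n2 e1 e2 k c :: int
  assumes "n1\<^sup>2 + c = k * e1\<^sup>2" "n2\<^sup>2 + c = k * e2\<^sup>2" "0 < c" "c \<le> 2"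
    "e1 \<le> n1" "e2 \<le> n2" "0 < e1" "e1 < e2"
  shows "e1 \<le> 2 * (e2 - e1)"
proof -
  have eq: "(n2 * e1 - n1 * e2) * (n2 * e1 + n1 * e2) = c * (e2\<^sup>2 - e1\<^sup>2)"
  proof -
    have "(n2 * e1 - n1 * e2) * (n2 * e1 + n1 * e2) = n2\<^sup>2 * e1\<^sup>2 - n1\<^sup>2 * e2\<^sup>2"
      by (simp add: power2_eq_square algebra_simps)
    also have "\<dots> = (k * e2\<^sup>2 - c) * e1\<^sup>2 - (k * e1\<^sup>2 - c) * e2\<^sup>2"
      using assms(1,2) by (metis add_diff_cancel_right')
    finally show ?thesis by (simp add: algebra_simps)
  qed
  have sq: "e2\<^sup>2 - e1\<^sup>2 = (e2 - e1) * (e2 + e1)" by (simp add: power2_eq_square algebra_simps)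
  have pos: "n2 * e1 + n1 * e2 > 0" using assms by (intro add_pos_pos mult_pos_pos) auto
  have "c * (e2\<^sup>2 - e1\<^sup>2) > 0" unfolding sq using assms by (intro mult_pos_pos) auto
  then have "n2 * e1 - n1 * e2 > 0" using eq pos by (metis zero_less_mult_pos2)
  \<comment> \<open>A positive integer is at least 1: integrality of
    \<open>n2 * e1 - n1 * e2\<close> is the source of the spacing.\<close>
  then have "1 * (n2 * e1 + n1 * e2) \<le> (n2 * e1 - n1 * e2) * (n2 * e1 + n1 * e2)"
    using pos by (intro mult_right_mono) auto
  also have "\<dots> \<le> 2 * (e2\<^sup>2 - e1\<^sup>2)"
    unfolding eq using assms by (intro mult_right_mono) (auto simp: sq)
  also have "\<dots> = 2 * ((e2 - e1) * (e2 + e1))" unfolding sq ..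
  also have "\<dots> \<le> 2 * ((e2 - e1) * (2 * e2))" using assms by (intro mult_left_mono) auto
  finally have "n2 * e1 + n1 * e2 \<le> 4 * (e2 - e1) * e2" by (simp add: algebra_simps)
  moreover have "e2 * e1 \<le> n2 * e1" "e1 * e2 \<le> n1 * e2" using assms by (auto intro!: mult_right_mono)
  ultimately have "2 * e1 * e2 \<le> 4 * (e2 - e1) * e2" by (simp add: algebra_simps)
  then have "(2 * e1) * e2 \<le> (4 * (e2 - e1)) * e2" .
  then have "2 * e1 \<le> 4 * (e2 - e1)" using assms by (simp only: mult_le_cancel_right)
  then show ?thesis by simp
qed

text \<open>This supplies the hypothesis \<open>e \<le> n\<close> of \<open>pell_gap\<close>. The
  case \<open>k = 1\<close> would need two squares at distance 1 or 2, impossible for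
  \<open>e \<ge> 2\<close>; for \<open>k \<ge> 2\<close> the size of \<open>k * e^2\<close>
  decides.\<close>

lemma pell_root_le:
  fixes n e k c :: nat
  assumes "n\<^sup>2 + c = k * e\<^sup>2" "c \<in> {1, 2}" "e \<ge> 2"
  shows "e \<le> n"
proof -
  have "k \<noteq> 0" using assms by (intro notI) auto
  moreover have "k \<noteq> 1"
  proof
    assume "k = 1"
    then have eq: "n\<^sup>2 + c = e\<^sup>2" using assms by simp
    then have "n < e" using assms by (intro power_less_imp_less_base[of n 2 e]) auto
    then have "(n + 1)\<^sup>2 \<le> e\<^sup>2" by (intro power_mono) auto
    then have "2 * n + 1 \<le> 2" using eq assms(2) by (auto simp: power2_eq_square)
    then have "n = 0" by simp
    then have "e\<^sup>2 \<le> 2" using eq assms(2) by auto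
    moreover have "2\<^sup>2 \<le> e\<^sup>2" using assms(3) by (intro power_mono) auto
    ultimately show False by simp
  qed
  ultimately have "k \<ge> 2" by linarith
  then have "2 * e\<^sup>2 \<le> n\<^sup>2 + c" using assms(1) by simp
  moreover have "4 \<le> e\<^sup>2" using power_mono[OF assms(3), of 2] by simp
  moreover have "c \<le> 2" using assms(2) by auto
  ultimately have "e\<^sup>2 \<le> n\<^sup>2" by linarith
  then show ?thesis by (simp add: power2_nat_le_eq_le)
qed

text \<open>The \<open>n\<close> are mapped injectively to pairs of a Pell parameter
  \<open>k\<close>, at most \<open>3 * (M / E)^2\<close>, and a cell containing \<open>e\<close>,
  numbered up to \<open>2 * (M / E)\<close>.\<close>

lemma card_large_square_divisor:
  fixes M c :: nat and E :: real
  assumes "1 \<le> E" "E \<le> real M" "c \<in> {1, 2}"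
  shows "real (card {n. n < M \<and> (\<exists>e. E < real e \<and> e\<^sup>2 dvd n\<^sup>2 + c)}) \<le> 12 * (real M / E) ^ 3"
proof -
  define S where "S = {n. n < M \<and> (\<exists>e. E < real e \<and> e\<^sup>2 dvd n\<^sup>2 + c)}"
  have "\<forall>n\<in>S. \<exists>e k. E < real e \<and> n\<^sup>2 + c = k * e\<^sup>2" by (auto simp: S_def dvd_def mult.commute)
  then obtain e k where ek: "\<And>n. n \<in> S \<Longrightarrow> E < real (e n) \<and> n\<^sup>2 + c = k n * (e n)\<^sup>2"
    by metis
  have e2: "e n \<ge> 2" if "n \<in> S" for n using ek[OF that] assms(1) by linarith
  have en: "e n \<le> n" if "n \<in> S" for n
    using ek[OF that] e2[OF that] assms(3) pell_root_le by blast
  \<comment> \<open>The cells have length \<open>E / 2\<close>. For equal \<open>k\<close>,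
    \<open>pell_gap\<close> keeps two distinct values of \<open>e\<close> more than
    \<open>E / 2\<close> apart, so they never share a cell.\<close>
  define h where "h n = (k n, nat \<lfloor>2 * real (e n) / E\<rfloor>)" for n
  have neq: False if "h n = h m" "n \<in> S" "m \<in> S" "e n < e m" for n m
  proof -
    have "k n = k m" using that(1) by (simp add: h_def)
    then have "int (n\<^sup>2 + c) = int (k n * (e n)\<^sup>2)" "int (m\<^sup>2 + c) = int (k n * (e m)\<^sup>2)"
      using ek that by metis+
    then have "int (e n) \<le> 2 * (int (e m) - int (e n))"
      using e2[OF that(2)] en[OF that(2)] en[OF that(3)] assms(3) that(4)
      by (intro pell_gap[of "int n" "int c" "int (k n)" "int (e n)" "int m" "int (e m)"]) auto
    then have "int (3 * e n) \<le> int (2 * e m)" by simp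
    then have "3 * e n \<le> 2 * e m" by (simp only: of_nat_le_iff)
    then have "E < 2 * real (e m) - 2 * real (e n)" using ek[OF that(2)] by linarith
    then have "(2 * real (e n) + E) / E < 2 * real (e m) / E"
      using assms(1) by (intro divide_strict_right_mono) auto
    then have "2 * real (e n) / E + 1 < 2 * real (e m) / E"
      using assms(1) by (simp add: add_divide_distrib)
    moreover have "2 * real (e n) / E \<ge> 0" using assms(1) by simp
    ultimately have "nat \<lfloor>2 * real (e n) / E\<rfloor> < nat \<lfloor>2 * real (e m) / E\<rfloor>" by linarith
    then show False using that(1) unfolding h_def prod.inject by linarith
  qed
  have inj: "inj_on h S"
  proof (rule inj_onI)
    fix n m assume nm: "n \<in> S" "m \<in> S" "h n = h m"
    then have "e n = e m" using neq[of n m] neq[of m n] by (metis linorder_neqE_nat)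
    then have "n\<^sup>2 + c = m\<^sup>2 + c" using ek nm by (simp add: h_def)
    then show "n = m" by simp
  qed
  let ?a = "nat \<lfloor>3 * (real M / E) ^ 2\<rfloor>" and ?b = "nat \<lfloor>2 * (real M / E)\<rfloor>"
  have "h ` S \<subseteq> {..?a} \<times> {..?b}"
  proof (rule image_subsetI)
    fix n assume n: "n \<in> S"
    have nM: "n < M" using n by (simp add: S_def)
    have "real (k n) * E ^ 2 \<le> real (k n) * real (e n) ^ 2"
      using ek[OF n] assms(1) by (intro mult_left_mono power_mono) auto
    also have "\<dots> = real (n\<^sup>2 + c)" using ek[OF n] by simp
    also have "\<dots> \<le> 3 * real M ^ 2"
    proof -
      have "real n ^ 2 \<le> real M ^ 2" using nM by (intro power_mono) auto
      moreover have "1 \<le> real M ^ 2" using assms by (intro one_le_power) auto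
      moreover have "real c \<le> 2" using assms by auto
      ultimately have "real n ^ 2 + real c \<le> 3 * real M ^ 2" by linarith
      then show ?thesis by simp
    qed
    finally have "real (k n) \<le> 3 * (real M / E) ^ 2" using assms(1) by (simp add: field_simps)
    then have "k n \<le> ?a" by (simp add: le_nat_floor)
    moreover have "2 * real (e n) / E \<le> 2 * (real M / E)"
      using en[OF n] nM assms(1) by (simp add: divide_right_mono)
    then have "nat \<lfloor>2 * real (e n) / E\<rfloor> \<le> ?b" by (intro nat_mono floor_mono)
    ultimately show "h n \<in> {..?a} \<times> {..?b}" by (simp add: h_def)
  qed
  then have "card S \<le> card ({..?a} \<times> {..?b})" by (intro card_inj_on_le[OF inj]) auto
  then have "real (card S) \<le> real (?a + 1) * real (?b + 1)"
    by (metis card_cartesian_product card_atMost Suc_eq_plus1 of_nat_le_iff of_nat_mult)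
  also have "\<dots> \<le> (4 * (real M / E) ^ 2) * (3 * (real M / E))"
  proof (rule mult_mono)
    \<comment> \<open>As \<open>M / E \<ge> 1\<close>, each \<open>+ 1\<close> is absorbed, turning
      the constants 3 and 2 into 4 and 3.\<close>
    have r1: "real M / E \<ge> 1" using assms by simp
    then have "(real M / E) ^ 2 \<ge> 1" by (rule one_le_power)
    moreover have "real ?a \<le> 3 * (real M / E) ^ 2" by (intro of_nat_floor) auto
    ultimately show "real (?a + 1) \<le> 4 * (real M / E) ^ 2" unfolding of_nat_add of_nat_1 by argo
    have "real ?b \<le> 2 * (real M / E)" using r1 by (intro of_nat_floor) auto
    then show "real (?b + 1) \<le> 3 * (real M / E)" using r1 unfolding of_nat_add of_nat_1 by argo
  qed (use assms in auto)
  also have "\<dots> = 12 * (real M / E) ^ 3" by (simp add: power2_eq_square power3_eq_cube)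
  finally show ?thesis by (simp add: S_def)
qed

lemma sum_rho_le:
  assumes "z > 0" "\<delta> > 0" "K \<ge> 0" "\<And>d. squarefree d \<Longrightarrow> real (rho d) \<le> K * real d powr \<delta>"
  shows "(\<Sum>d | squarefree d \<and> real d \<le> z. real (rho d)) \<le> K * z powr (1 + \<delta>)"
proof -
  have "(\<Sum>d | squarefree d \<and> real d \<le> z. real (rho d)) \<le> (\<Sum>d | squarefree d \<and> real d \<le> z. K * z powr \<delta>)"
  proof (rule sum_mono)
    fix d assume "d \<in> {d. squarefree d \<and> real d \<le> z}"
    then have d: "squarefree d" "real d \<le> z" by auto
    have "real (rho d) \<le> K * real d powr \<delta>" using assms(4) d by blast
    also have "\<dots> \<le> K * z powr \<delta>" using d assms by (intro mult_left_mono powr_mono2) auto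
    finally show "real (rho d) \<le> K * z powr \<delta>" .
  qed
  also have "\<dots> = real (card {d::nat. squarefree d \<and> real d \<le> z}) * (K * z powr \<delta>)" by simp
  also have "\<dots> \<le> z * (K * z powr \<delta>)"
  proof (rule mult_right_mono)
    have "{d::nat. squarefree d \<and> real d \<le> z} \<subseteq> {1..nat \<lfloor>z\<rfloor>}"
      by (auto simp: le_nat_floor Suc_le_eq intro!: gr0I)
    then have "card {d::nat. squarefree d \<and> real d \<le> z} \<le> nat \<lfloor>z\<rfloor>"
      using card_mono[of "{1..nat \<lfloor>z\<rfloor>}"] by simp
    then show "real (card {d::nat. squarefree d \<and> real d \<le> z}) \<le> z"
      using of_nat_floor[of z] assms(1) by linarith
  qed (use assms in auto)
  also have "\<dots> = K * z powr (1 + \<delta>)" using assms(1) by (simp add: powr_add)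
  finally show ?thesis .
qed

text \<open>The range of \<open>e\<close> is split at \<open>E\<close>. For
  \<open>D < e \<le> E\<close> the condition implies \<open>e^2 dvd quart n\<close>, so
  \<open>rho\<close> counts the \<open>n\<close> and gives the first two terms; \<open>e > E\<close>
  gives the Pell term.\<close>

lemma card_square_divisor_above:
  fixes M c :: nat and D E :: real
  assumes "1 \<le> E" "E \<le> real M" "c \<in> {1, 2}" "\<delta> > 0" "K \<ge> 0"
    and rho: "\<And>d. squarefree d \<Longrightarrow> real (rho d) \<le> K * real d powr \<delta>"
    and tail: "\<And>F. finite F \<Longrightarrow> (\<And>d. d \<in> F \<Longrightarrow> squarefree d \<and> D < real d) \<Longrightarrow>
       (\<Sum>d\<in>F. real (rho d) / real d ^ 2) \<le> B"
  shows "real (card {n. n < M \<and> (\<exists>e. squarefree e \<and> D < real e \<and> e\<^sup>2 dvd n\<^sup>2 + c)})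
    \<le> real M * B + K * E powr (1 + \<delta>) + 12 * (real M / E) ^ 3"
proof -
  define G where "G = {e::nat. squarefree e \<and> real e \<le> E \<and> D < real e}"
  define A where "A e = {n. n < M \<and> e\<^sup>2 dvd n\<^sup>2 + c}" for e
  define L where "L = {n. n < M \<and> (\<exists>e. E < real e \<and> e\<^sup>2 dvd n\<^sup>2 + c)}"
  have finG: "finite G" by (rule finite_subset[OF _ finite_squarefree_le[of E]]) (auto simp: G_def)
  have "{n. n < M \<and> (\<exists>e. squarefree e \<and> D < real e \<and> e\<^sup>2 dvd n\<^sup>2 + c)} \<subseteq> (\<Union>e\<in>G. A e) \<union> L"
  proof
    fix n assume "n \<in> {n. n < M \<and> (\<exists>e. squarefree e \<and> D < real e \<and> e\<^sup>2 dvd n\<^sup>2 + c)}"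
    then obtain e where "n < M" "squarefree e" "D < real e" "e\<^sup>2 dvd n\<^sup>2 + c" by blast
    then show "n \<in> (\<Union>e\<in>G. A e) \<union> L"
      by (cases "real e \<le> E") (auto simp: G_def A_def L_def not_le)
  qed
  moreover have finU: "finite ((\<Union>e\<in>G. A e) \<union> L)" using finG by (auto simp: A_def L_def)
  ultimately have "card {n. n < M \<and> (\<exists>e. squarefree e \<and> D < real e \<and> e\<^sup>2 dvd n\<^sup>2 + c)}
      \<le> card ((\<Union>e\<in>G. A e) \<union> L)" by (intro card_mono)
  also have "\<dots> \<le> card (\<Union>e\<in>G. A e) + card L" by (rule card_Un_le)
  also have "card (\<Union>e\<in>G. A e) \<le> (\<Sum>e\<in>G. card (A e))" by (rule card_UN_le[OF finG])
  finally have "real (card {n. n < M \<and> (\<exists>e. squarefree e \<and> D < real e \<and> e\<^sup>2 dvd n\<^sup>2 + c)})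
      \<le> (\<Sum>e\<in>G. real (card (A e))) + real (card L)"
    by (simp flip: of_nat_sum of_nat_add)
  also have "(\<Sum>e\<in>G. real (card (A e))) \<le> (\<Sum>e\<in>G. real M * (real (rho e) / real e ^ 2) + real (rho e))"
  proof (rule sum_mono)
    fix e assume "e \<in> G"
    then have "e > 0" by (auto simp: G_def intro!: gr0I)
    have "A e \<subseteq> {n. n < M \<and> e\<^sup>2 dvd quart n}"
    proof
      fix n assume "n \<in> A e"
      then have "n < M" "e\<^sup>2 dvd n\<^sup>2 + 1 \<or> e\<^sup>2 dvd n\<^sup>2 + 2" using assms(3) by (auto simp: A_def)
      then show "n \<in> {n. n < M \<and> e\<^sup>2 dvd quart n}"
        unfolding quart_def using dvd_mult dvd_mult2 by blast
    qed
    then have "card (A e) \<le> card {n. n < M \<and> e\<^sup>2 dvd quart n}" by (intro card_mono) auto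
    then show "real (card (A e)) \<le> real M * (real (rho e) / real e ^ 2) + real (rho e)"
      using card_square_dvd_quart_bounds[OF \<open>e > 0\<close>, of M] by linarith
  qed
  also have "\<dots> = real M * (\<Sum>e\<in>G. real (rho e) / real e ^ 2) + (\<Sum>e\<in>G. real (rho e))"
    by (simp add: sum.distrib sum_distrib_left)
  also have "\<dots> \<le> real M * B + K * E powr (1 + \<delta>)"
  proof (rule add_mono)
    show "real M * (\<Sum>e\<in>G. real (rho e) / real e ^ 2) \<le> real M * B"
      using finG by (intro mult_left_mono tail) (auto simp: G_def)
    have "(\<Sum>e\<in>G. real (rho e)) \<le> (\<Sum>e | squarefree e \<and> real e \<le> E. real (rho e))"
      by (rule sum_mono2[OF finite_squarefree_le]) (auto simp: G_def)
    also have "\<dots> \<le> K * E powr (1 + \<delta>)" using assms by (intro sum_rho_le) auto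
    finally show "(\<Sum>e\<in>G. real (rho e)) \<le> K * E powr (1 + \<delta>)" .
  qed
  finally show ?thesis using card_large_square_divisor[OF assms(1-3)] unfolding L_def by linarith
qed

text \<open>A divisor of a product splits along its factors. Since \<open>a\<close> is coprime to
  \<open>n^2 + 2\<close>, all of \<open>a^2\<close> must divide \<open>n^2 + 1\<close>, and
  symmetrically for \<open>b\<close>.\<close>

lemma square_dvd_quart_split:
  assumes "squarefree d" "d\<^sup>2 dvd quart n"
  obtains a b where "d = a * b" "squarefree a" "squarefree b" "a\<^sup>2 dvd n\<^sup>2 + 1" "b\<^sup>2 dvd n\<^sup>2 + 2"
proof -
  have "d dvd quart n" using assms(2) dvd_trans[of d "d\<^sup>2"] by simp
  then obtain a b where ab: "d = a * b" "a dvd n\<^sup>2 + 1" "b dvd n\<^sup>2 + 2"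
    using division_decomp unfolding quart_def by metis
  have sq: "a\<^sup>2 dvd quart n" "b\<^sup>2 dvd quart n"
    using assms(2) ab(1) dvd_trans by (auto simp: power_mult_distrib intro: dvd_mult_left dvd_mult_right)
  have "coprime (a\<^sup>2) (n\<^sup>2 + 2)" "coprime (b\<^sup>2) (n\<^sup>2 + 1)"
    using coprime_divisors[OF ab(2) dvd_refl coprime_quart_factors]
      coprime_divisors[OF dvd_refl ab(3) coprime_quart_factors] by (simp_all add: coprime_commute)
  then have "a\<^sup>2 dvd n\<^sup>2 + 1" "b\<^sup>2 dvd n\<^sup>2 + 2"
    using sq coprime_dvd_mult_left_iff coprime_dvd_mult_right_iff unfolding quart_def by blast+
  then show ?thesis using that ab(1) squarefree_multD assms(1) by blast
qed

text \<open>For \<open>d \<le> D^2\<close> the error comes from rounding in the periodic counts and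
  from truncating the singular series. The \<open>n\<close> met by larger \<open>d\<close> are
  counted for \<open>c = 1\<close> and \<open>c = 2\<close>, hence the factor 2, and each carries at
  most \<open>K * (6 * M ^ 4) powr \<delta>\<close> divisor terms.\<close>

lemma squarefree_quart_count_bound:
  fixes M :: nat and D E :: real
  assumes "D > 0" "1 \<le> E" "E \<le> real M" "\<delta> > 0" "K \<ge> 0"
    and omega: "\<And>d. d > 0 \<Longrightarrow> 4 ^ card (prime_factors d) \<le> K * real d powr \<delta>"
    and rho: "\<And>d. squarefree d \<Longrightarrow> real (rho d) \<le> K * real d powr \<delta>"
    and tail: "\<And>z F. z > 0 \<Longrightarrow> finite F \<Longrightarrow> (\<And>d. d \<in> F \<Longrightarrow> squarefree d \<and> z < real d) \<Longrightarrow>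
       (\<Sum>d\<in>F. real (rho d) / real d ^ 2) \<le> B z"
  shows "\<bar>real (card {n. n < M \<and> squarefree (quart n)}) - sigma_const * real M\<bar> \<le>
    K * (D\<^sup>2) powr (1 + \<delta>) + real M * B (D\<^sup>2) +
    2 * (real M * B D + K * E powr (1 + \<delta>) + 12 * (real M / E) ^ 3) * (K * (6 * real M ^ 4) powr \<delta>)"
proof -
  define z where "z = D\<^sup>2"
  have z0: "z > 0" using assms by (simp add: z_def)
  define G where "G = {d::nat. squarefree d \<and> real d \<le> z}"
  have finG: "finite G" unfolding G_def by (rule finite_squarefree_le)
  let ?Q = "\<lambda>n. {d. squarefree d \<and> d\<^sup>2 dvd quart n}"
  have finQ: "finite (?Q n)" for n by (rule finite_square_divisors[OF quart_pos])
  define R where "R n = (\<Sum>d\<in>?Q n - G. mob d)" for n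
  define A where "A d = {n. n < M \<and> d\<^sup>2 dvd quart n}" for d
  define W where "W c = {n. n < M \<and> (\<exists>e. squarefree e \<and> D < real e \<and> e\<^sup>2 dvd n\<^sup>2 + c)}" for c :: nat
  \<comment> \<open>An upper bound for the number of square divisors of \<open>quart n\<close>,
    valid because \<open>quart n \<le> 6 * M ^ 4\<close> for \<open>n < M\<close>.\<close>
  define V where "V = K * (6 * real M ^ 4) powr \<delta>"
  define H where "H = real M * B D + K * E powr (1 + \<delta>) + 12 * (real M / E) ^ 3"

  have "real (card {n. n < M \<and> squarefree (quart n)}) = (\<Sum>n<M. if squarefree (quart n) then 1 else 0)"
    by (simp add: sum.If_cases Int_def)
  also have "\<dots> = (\<Sum>n<M. \<Sum>d\<in>?Q n. mob d)"
    by (simp add: sum_mob_square_divisors[OF quart_pos])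
  also have "\<dots> = (\<Sum>n<M. (\<Sum>d\<in>{d \<in> G. d\<^sup>2 dvd quart n}. mob d) + R n)"
  proof (rule sum.cong)
    fix n
    have "(\<Sum>d\<in>?Q n. mob d) = (\<Sum>d\<in>?Q n \<inter> G. mob d) + R n"
      unfolding R_def by (rule sum.Int_Diff[OF finQ])
    also have "?Q n \<inter> G = {d \<in> G. d\<^sup>2 dvd quart n}" by (auto simp: G_def)
    finally show "(\<Sum>d\<in>?Q n. mob d) = (\<Sum>d\<in>{d \<in> G. d\<^sup>2 dvd quart n}. mob d) + R n" .
  qed simp
  also have "\<dots> = (\<Sum>n<M. \<Sum>d\<in>{d \<in> G. d\<^sup>2 dvd quart n}. mob d) + (\<Sum>n<M. R n)"
    by (rule sum.distrib)
  also have "(\<Sum>n<M. \<Sum>d\<in>{d \<in> G. d\<^sup>2 dvd quart n}. mob d) =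
             (\<Sum>d\<in>G. \<Sum>n\<in>{n \<in> {..<M}. d\<^sup>2 dvd quart n}. mob d)"
    by (rule sum.swap_restrict) (use finG in auto)
  also have "\<dots> = (\<Sum>d\<in>G. mob d * real (card (A d)))"
    by (simp add: A_def mult.commute)
  finally have main: "real (card {n. n < M \<and> squarefree (quart n)}) =
      (\<Sum>d\<in>G. mob d * real (card (A d))) + (\<Sum>n<M. R n)" .

  have "\<bar>(\<Sum>d\<in>G. mob d * real (card (A d))) - real M * (\<Sum>d\<in>G. mob d * (real (rho d) / real d ^ 2))\<bar>
      = \<bar>\<Sum>d\<in>G. mob d * (real (card (A d)) - real M * (real (rho d) / real d ^ 2))\<bar>"
    by (simp add: sum_distrib_left sum_subtractf[symmetric] algebra_simps)
  also have "\<dots> \<le> (\<Sum>d\<in>G. \<bar>mob d * (real (card (A d)) - real M * (real (rho d) / real d ^ 2))\<bar>)"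
    by (rule sum_abs)
  also have "\<dots> \<le> (\<Sum>d\<in>G. real (rho d))"
  proof (rule sum_mono)
    fix d assume "d \<in> G"
    then have "d > 0" by (auto simp: G_def intro!: gr0I)
    have "\<bar>mob d\<bar> = 1" by (simp add: mob_def power_abs)
    then show "\<bar>mob d * (real (card (A d)) - real M * (real (rho d) / real d ^ 2))\<bar> \<le> real (rho d)"
      using card_square_dvd_quart_bounds[OF \<open>d > 0\<close>, of M] by (simp only: abs_mult A_def mult_1)
  qed
  also have "\<dots> \<le> K * z powr (1 + \<delta>)"
    unfolding G_def using z0 assms by (intro sum_rho_le) auto
  finally have e1: "\<bar>(\<Sum>d\<in>G. mob d * real (card (A d))) -
      real M * (\<Sum>d\<in>G. mob d * (real (rho d) / real d ^ 2))\<bar> \<le> K * z powr (1 + \<delta>)" .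

  have "\<bar>(\<Sum>d\<in>G. mob d * (real (rho d) / real d ^ 2)) - sigma_const\<bar> \<le> B z"
    unfolding G_def by (intro sigma_truncation_bound tail[OF z0])
  then have "real M * \<bar>(\<Sum>d\<in>G. mob d * (real (rho d) / real d ^ 2)) - sigma_const\<bar> \<le> real M * B z"
    by (rule mult_left_mono) simp
  then have e2: "\<bar>real M * (\<Sum>d\<in>G. mob d * (real (rho d) / real d ^ 2)) - sigma_const * real M\<bar> \<le> real M * B z"
    by (simp add: abs_mult[symmetric] abs_mult_pos' algebra_simps)

  have R_le: "\<bar>R n\<bar> \<le> V" if "n < M" for n
  proof -
    have M1: "real M \<ge> 1" using that by simp
    have "\<bar>R n\<bar> \<le> (\<Sum>d\<in>?Q n - G. \<bar>mob d\<bar>)" unfolding R_def by (rule sum_abs)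
    also have "\<dots> = real (card (?Q n - G))" by (simp add: mob_def power_abs)
    also have "\<dots> \<le> real (card (?Q n))" using finQ by (simp add: card_mono)
    also have "\<dots> \<le> 2 ^ card (prime_factors (quart n))"
      using card_square_divisors_le[OF quart_pos, of n]
      by (metis of_nat_le_iff of_nat_numeral of_nat_power)
    \<comment> \<open>Enlarging the base from 2 to 4 lets the hypothesis \<open>omega\<close> apply
      as it stands.\<close>
    also have "\<dots> \<le> 4 ^ card (prime_factors (quart n))" by (rule power_mono) auto
    also have "\<dots> \<le> K * real (quart n) powr \<delta>" by (rule omega[OF quart_pos])
    also have "\<dots> \<le> V"
    proof -
      have nM: "real n ^ 2 \<le> real M ^ 2" using that by (intro power_mono) auto
      have "1 \<le> real M ^ 2" using M1 by (rule one_le_power)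
      then have "real n ^ 2 + 1 \<le> 2 * real M ^ 2" "real n ^ 2 + 2 \<le> 3 * real M ^ 2"
        using nM by linarith+
      then have "(real n ^ 2 + 1) * (real n ^ 2 + 2) \<le> (2 * real M ^ 2) * (3 * real M ^ 2)"
        by (intro mult_mono) auto
      moreover have "real (quart n) = (real n ^ 2 + 1) * (real n ^ 2 + 2)"
        unfolding quart_def by (simp only: of_nat_mult of_nat_add of_nat_power of_nat_1 of_nat_numeral)
      ultimately have "real (quart n) \<le> 6 * real M ^ 4" by (simp add: power_add[symmetric])
      then show ?thesis unfolding V_def using assms by (intro mult_left_mono powr_mono2) auto
    qed
    finally show ?thesis .
  qed
  \<comment> \<open>A divisor \<open>d > D^2\<close> splits as \<open>a * b\<close> with
    \<open>a > D\<close> or \<open>b > D\<close>, which places \<open>n\<close> in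
    \<open>W 1\<close> or \<open>W 2\<close>.\<close>
  have R_0: "R n = 0" if "n < M" "n \<notin> W 1 \<union> W 2" for n
  proof -
    have "?Q n - G = {}"
    proof (rule ccontr)
      assume "?Q n - G \<noteq> {}"
      then obtain d where "d \<in> ?Q n" "d \<notin> G" by blast
      then have d: "squarefree d" "d\<^sup>2 dvd quart n" "real d > z" by (auto simp: G_def)
      then obtain a b where ab: "d = a * b" "squarefree a" "squarefree b" "a\<^sup>2 dvd n\<^sup>2 + 1" "b\<^sup>2 dvd n\<^sup>2 + 2"
        using square_dvd_quart_split by blast
      then have "real a \<le> D" "real b \<le> D" using that unfolding W_def by force+
      then have "real a * real b \<le> D * D" using assms(1) by (intro mult_mono) auto
      then show False using d(3) ab(1) by (simp add: z_def power2_eq_square)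
    qed
    then show ?thesis by (simp only: R_def sum.empty)
  qed
  have "(\<Sum>n<M. R n) = (\<Sum>n\<in>W 1 \<union> W 2. R n)"
    by (rule sum.mono_neutral_right) (auto intro!: R_0 simp: W_def)
  then have "\<bar>\<Sum>n<M. R n\<bar> \<le> (\<Sum>n\<in>W 1 \<union> W 2. \<bar>R n\<bar>)" by (simp add: sum_abs)
  also have "\<dots> \<le> (\<Sum>n\<in>W 1 \<union> W 2. V)" by (intro sum_mono R_le) (auto simp: W_def)
  also have "\<dots> = real (card (W 1 \<union> W 2)) * V" by simp
  also have "\<dots> \<le> (2 * H) * V"
  proof (rule mult_right_mono)
    have W: "real (card (W c)) \<le> H" if "c \<in> {1, 2}" for c
      unfolding W_def H_def using assms that by (intro card_square_divisor_above tail) auto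
    have "real (card (W 1 \<union> W 2)) \<le> real (card (W 1)) + real (card (W 2))"
      using card_Un_le[of "W 1" "W 2"] by linarith
    then show "real (card (W 1 \<union> W 2)) \<le> 2 * H" using W[of 1] W[of 2] by simp
  qed (use assms in \<open>simp add: V_def\<close>)
  finally show ?thesis using main e1 e2 unfolding z_def[symmetric] H_def[symmetric] V_def[symmetric]
    by linarith
qed

subsection \<open>The asymptotic formula\<close>

text \<open>The slack between 7/9 and 8/9 allows one fixed \<open>\<delta>\<close>, so no
  \<open>\<epsilon>\<close> appears in this bound.\<close>

lemma squarefree_quart_count_asymp:
  obtains C :: real where
    "\<And>M. M \<ge> 1 \<Longrightarrow> \<bar>real (card {n. n < M \<and> squarefree (quart n)}) - sigma_const * real M\<bar> \<le> C * real M powr (8/9)"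
proof -
  define \<delta> :: real where "\<delta> = 1/100"
  obtain K where K: "K \<ge> 1" "\<And>d. d > 0 \<Longrightarrow> 4 ^ card (prime_factors d) \<le> K * real d powr \<delta>"
    "\<And>d. squarefree d \<Longrightarrow> real (rho d) \<le> K * real d powr \<delta>"
    using rho_powr_bound[of \<delta>] by (auto simp: \<delta>_def)
  obtain L where L: "L \<ge> 0"
    "\<And>z F. z > 0 \<Longrightarrow> finite F \<Longrightarrow> (\<And>d. d \<in> F \<Longrightarrow> squarefree d \<and> z < real d) \<Longrightarrow>
       (\<Sum>d\<in>F. real (rho d) / real d ^ 2) \<le> L * z powr (2 * \<delta> - 1)"
    using rho_tail_bound[of \<delta> K] K by (auto simp: \<delta>_def)
  have "\<bar>real (card {n. n < M \<and> squarefree (quart n)}) - sigma_const * real M\<bar>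
      \<le> (K + L + 12 * K * (L + K + 12)) * real M powr (8/9)" if "M \<ge> 1" for M
  proof -
    define x where "x = real M"
    have x1: "x \<ge> 1" using that by (simp add: x_def)
    \<comment> \<open>This makes the cutoff \<open>D^2\<close> equal to \<open>x powr (2/3)\<close>.
      With \<open>E\<close> as below, the root counts up to \<open>E\<close> cost about
      \<open>x powr (7/9)\<close> and the Pell term \<open>(x / E) ^ 3\<close> is
      \<open>x powr (2/3)\<close>.\<close>
    define D where "D = x powr (1/3)"
    define E where "E = x powr (7/9)"
    have mono: "x powr a \<le> x powr b" if "a \<le> b" for a b using x1 that by (rule powr_mono[rotated])
    have E: "1 \<le> E" "E \<le> x"
      using mono[of 0 "7/9"] mono[of "7/9" 1] x1 by (auto simp: E_def)
    have D: "D > 0" using x1 by (simp add: D_def)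
    have bound: "\<bar>real (card {n. n < M \<and> squarefree (quart n)}) - sigma_const * real M\<bar> \<le>
      K * (D\<^sup>2) powr (1 + \<delta>) + x * (L * (D\<^sup>2) powr (2 * \<delta> - 1)) +
      2 * (x * (L * D powr (2 * \<delta> - 1)) + K * E powr (1 + \<delta>) + 12 * (x / E) ^ 3) * (K * (6 * x ^ 4) powr \<delta>)"
      unfolding x_def using D E K L
      by (intro squarefree_quart_count_bound[where B = "\<lambda>z. L * z powr (2 * \<delta> - 1)"]) (auto simp: x_def \<delta>_def)
    have D2: "D\<^sup>2 = x powr (2/3)" using x1 by (simp add: D_def powr_power)
    have "K * (D\<^sup>2) powr (1 + \<delta>) \<le> K * x powr (8/9)"
      unfolding D2 powr_powr using K by (intro mult_left_mono mono) (auto simp: \<delta>_def)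
    moreover have "x * (L * (D\<^sup>2) powr (2 * \<delta> - 1)) \<le> L * x powr (8/9)"
    proof -
      have "x * (L * (D\<^sup>2) powr (2 * \<delta> - 1)) = L * x powr (1 + 2/3 * (2 * \<delta> - 1))"
        unfolding D2 powr_powr using x1 by (simp add: powr_add)
      also have "\<dots> \<le> L * x powr (8/9)" using L by (intro mult_left_mono mono) (auto simp: \<delta>_def)
      finally show ?thesis .
    qed
    \<comment> \<open>The three exponents are about 0.673, 0.786 and 0.667, all below 4/5. The
      divisor factor adds \<open>4 * \<delta> = 1/25\<close>, for a total of 21/25, still below
      8/9.\<close>
    moreover have "2 * (x * (L * D powr (2 * \<delta> - 1)) + K * E powr (1 + \<delta>) + 12 * (x / E) ^ 3) * (K * (6 * x ^ 4) powr \<delta>)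
        \<le> 2 * ((L + K + 12) * x powr (4/5)) * (K * (6 * x powr (4 * \<delta>)))"
    proof (intro mult_mono mult_left_mono)
      have "x * (L * D powr (2 * \<delta> - 1)) = L * x powr (1 + 1/3 * (2 * \<delta> - 1))"
        unfolding D_def powr_powr using x1 by (simp add: powr_add)
      also have "\<dots> \<le> L * x powr (4/5)" using L by (intro mult_left_mono mono) (auto simp: \<delta>_def)
      finally have 1: "x * (L * D powr (2 * \<delta> - 1)) \<le> L * x powr (4/5)" .
      have 2: "K * E powr (1 + \<delta>) \<le> K * x powr (4/5)"
        unfolding E_def powr_powr using K by (intro mult_left_mono mono) (auto simp: \<delta>_def)
      have "x / E = x powr (2/9)" using x1 powr_diff[of x 1 "7/9"] by (simp add: E_def)
      then have "(x / E) ^ 3 = x powr (2/3)" using x1 by (simp add: powr_power)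
      also have "\<dots> \<le> x powr (4/5)" by (rule mono) simp
      finally show "x * (L * D powr (2 * \<delta> - 1)) + K * E powr (1 + \<delta>) + 12 * (x / E) ^ 3 \<le> (L + K + 12) * x powr (4/5)"
        using 1 2 by (simp add: algebra_simps)
      have "(6 * x ^ 4) powr \<delta> = 6 powr \<delta> * (x powr 4) powr \<delta>"
        using x1 by (simp add: powr_mult powr_numeral)
      also have "\<dots> \<le> 6 powr 1 * (x powr 4) powr \<delta>"
        by (intro mult_right_mono powr_mono) (auto simp: \<delta>_def)
      finally show "(6 * x ^ 4) powr \<delta> \<le> 6 * x powr (4 * \<delta>)" by (simp add: powr_powr)
    qed (use K L x1 E in \<open>auto intro!: add_nonneg_nonneg mult_nonneg_nonneg\<close>)
    moreover have "2 * ((L + K + 12) * x powr (4/5)) * (K * (6 * x powr (4 * \<delta>)))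
        \<le> 12 * K * (L + K + 12) * x powr (8/9)"
    proof -
      have "2 * ((L + K + 12) * x powr (4/5)) * (K * (6 * x powr (4 * \<delta>))) =
          12 * K * (L + K + 12) * (x powr (4/5) * x powr (4 * \<delta>))" by (simp add: mult_ac)
      also have "\<dots> = 12 * K * (L + K + 12) * x powr (4/5 + 4 * \<delta>)" by (simp add: powr_add)
      also have "\<dots> \<le> 12 * K * (L + K + 12) * x powr (8/9)"
        using K L by (intro mult_left_mono mono) (auto simp: \<delta>_def)
      finally show ?thesis .
    qed
    ultimately show ?thesis using bound unfolding x_def[symmetric] by (simp add: algebra_simps)
  qed
  then show ?thesis using that by blast
qed

text \<open>The subtracted 1 is the term \<open>n = 0\<close>: the periodic counts start at 0, and
  \<open>quart 0 = 2\<close> is squarefree.\<close>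

lemma Gamma_count_eq:
  assumes "X \<ge> 0"
  shows "Gamma_count X = real (card {n. n < nat \<lfloor>X\<rfloor> + 1 \<and> squarefree (quart n)}) - 1"
proof -
  define T where "T = {n. n < nat \<lfloor>X\<rfloor> + 1 \<and> squarefree (quart n)}"
  have le: "real n \<le> X \<longleftrightarrow> n < nat \<lfloor>X\<rfloor> + 1" for n
    using assms by (simp add: le_nat_floor less_Suc_eq_le) linarith
  have fin: "finite {n::nat. 1 \<le> n \<and> real n \<le> X}" unfolding le by auto
  have "Gamma_count X = (\<Sum>n | 1 \<le> n \<and> real n \<le> X. if squarefree (quart n) then 1 else 0)"
    unfolding Gamma_count_def by (intro sum.cong) (auto simp: mu_sq_def squarefree_quart_iff)
  also have "\<dots> = real (card {n. 1 \<le> n \<and> real n \<le> X \<and> squarefree (quart n)})"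
    using fin by (simp add: sum.If_cases Int_def conj_assoc)
  also have "{n. 1 \<le> n \<and> real n \<le> X \<and> squarefree (quart n)} = T - {0}"
    by (auto simp: T_def le)
  also have "real (card (T - {0})) = real (card T) - 1"
  proof -
    have "quart 0 = 2" by (simp add: quart_def)
    then have "0 \<in> T" by (simp add: T_def squarefree_prime)
    moreover have "finite T" by (simp add: T_def)
    ultimately have "card T = Suc (card (T - {0}))" by (intro card.remove)
    then show ?thesis by simp
  qed
  finally show ?thesis by (simp add: T_def)
qed

theorem theorem1:
  fixes \<epsilon> :: real
  assumes "\<epsilon> > 0"
  shows "(\<lambda>X. Gamma_count X - sigma_const * X) \<in> O[at_top](\<lambda>X. X powr (8/9 + \<epsilon>))"
proof -
  obtain C where C: "\<And>M. M \<ge> 1 \<Longrightarrow>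
      \<bar>real (card {n. n < M \<and> squarefree (quart n)}) - sigma_const * real M\<bar> \<le> C * real M powr (8/9)"
    using squarefree_quart_count_asymp by blast
  show ?thesis
  proof (rule bigoI)
    show "\<forall>\<^sub>F X in at_top. norm (Gamma_count X - sigma_const * X)
        \<le> (2 * \<bar>C\<bar> + 1 + \<bar>sigma_const\<bar>) * norm (X powr (8/9 + \<epsilon>))"
      using eventually_ge_at_top[of 1]
    proof eventually_elim
      case (elim X)
      \<comment> \<open>For \<open>X \<ge> 1\<close> this gives
        \<open>X \<le> M \<le> 2 * X\<close>, which turns \<open>C\<close> into at most
        \<open>2 * |C|\<close>. The removed term \<open>n = 0\<close> and the shift
        \<open>M - X \<le> 1\<close> account for the summands 1 and \<open>|sigma_const|\<close> of
        the constant.\<close>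
      define M where "M = nat \<lfloor>X\<rfloor> + 1"
      have M: "M \<ge> 1" "X \<le> real M" "real M \<le> X + 1" using elim unfolding M_def by linarith+
      let ?P = "X powr (8/9 + \<epsilon>)"
      have P1: "1 \<le> ?P" using elim assms by (intro ge_one_powr_ge_zero) auto
      have "real M powr (8/9) \<le> (2 * X) powr (8/9)" using M elim by (intro powr_mono2) auto
      also have "\<dots> = 2 powr (8/9) * X powr (8/9)" using elim by (simp add: powr_mult)
      also have "\<dots> \<le> 2 powr 1 * ?P" using elim assms by (intro mult_mono powr_mono) auto
      finally have "\<bar>C\<bar> * real M powr (8/9) \<le> \<bar>C\<bar> * (2 * ?P)" by (intro mult_left_mono) auto
      moreover have "C * real M powr (8/9) \<le> \<bar>C\<bar> * real M powr (8/9)" by (intro mult_right_mono) auto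
      moreover have "\<bar>sigma_const * real M - sigma_const * X\<bar> \<le> \<bar>sigma_const\<bar> * ?P"
      proof -
        have "\<bar>sigma_const * real M - sigma_const * X\<bar> = \<bar>sigma_const\<bar> * \<bar>real M - X\<bar>"
          by (simp add: abs_mult[symmetric] right_diff_distrib)
        also have "\<dots> \<le> \<bar>sigma_const\<bar> * ?P" using M P1 by (intro mult_left_mono) auto
        finally show ?thesis .
      qed
      moreover have "Gamma_count X = real (card {n. n < M \<and> squarefree (quart n)}) - 1"
        using Gamma_count_eq[of X] elim by (simp add: M_def)
      ultimately have "\<bar>Gamma_count X - sigma_const * X\<bar> \<le> \<bar>C\<bar> * (2 * ?P) + 1 * ?P + \<bar>sigma_const\<bar> * ?P"
        using C[OF M(1)] P1 by linarith
      then show ?case by (simp add: algebra_simps)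
    qed
  qed
qed

end
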